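(* Let $X$ be a real normed linear space, $\Omega\subseteq X$ a nonempty closed set, $v\in X$ nonzero, and $T(x):=\inf\{t\ge 0\mid x+tv\in\Omega\}$. For any $\bar x\in\operatorname{dom}T\setminus\Omega$, with $\tilde x:=\bar x+T(\bar x)v$, one has $$\widehat\partial T(\bar x)\subseteq\{x^*\in X^*\mid\langle x^*,v\rangle=-1\}\cap\widehat N(\tilde x;\Omega).$$ Suppose further that $T$ is lower calm at $\bar x$. Then $$\widehat\partial T(\bar x)=\{x^*\in X^*\mid\langle x^*,v\rangle=-1\}\cap\widehat N(\tilde x;\Omega).$$
   Context: $T$ takes values in $[0,\infty]$ with $\inf\emptyset=\infty$, and $\operatorname{dom}T:=\{x\mid T(x)<\infty\}$; for $x\in\operatorname{dom}T$ the point $x+T(x)v$ lies in $\Omega$. $X^*$ is the topological dual of $X$. For $\psi:X\to(-\infty,\infty]$ and $\bar x\in\operatorname{dom}\psi$, the Fréchet subdifferential is $\widehat\partial\psi(\bar x):=\{x^*\in X^*\mid\langle x^*,x-\bar x\rangle\le\psi(x)-\psi(\bar x)+o(\|x-\bar x\|)\}$, i.e. for every $\varepsilon>0$ there is $\delta>0$ with $\langle x^*,x-\bar x\rangle\le\psi(x)-\psi(\bar x)+\varepsilon\|x-\bar x\|$ whenever $\|x-\bar x\|\le\delta$. For $y\in\Omega$, the Fréchet normal cone $\widehat N(y;\Omega)$ is the set of $x^*\in X^*$ such that for every $\varepsilon>0$ there is $\delta>0$ with $\langle x^*,x-y\rangle\le\varepsilon\|x-y\|$ for all $x\in\Omega$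 with $\|x-y\|\le\delta$. A function $\psi$ is lower calm at $\bar x\in\operatorname{dom}\psi$ if there exist $\ell\in\mathbb R$ and $\delta>0$ such that $\psi(x)-\psi(\bar x)\ge\ell\|x-\bar x\|$ for all $x$ with $\|x-\bar x\|\le\delta$. *)

theory Defs
  imports "HOL-Analysis.Analysis"
begin

text \<open>
  The topological dual of a real normed space \<open>'a\<close> is the type \<open>'a \<Rightarrow>\<^sub>L real\<close> of bounded
  linear functionals. Functions with values in the half-open interval from minus infinity
  (excluded) to infinity (included) are rendered as functions into \<^typ>\<open>ereal\<close>.
\<close>

definition domain :: "('a \<Rightarrow> ereal) \<Rightarrow> 'a set" where
  "domain \<psi> = {x. \<psi> x < \<infinity>}"

text \<open>The infimum is taken in \<^typ>\<open>ereal\<close>, so that it is \<open>\<infinity>\<close> for the empty set.\<close>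

definition min_time :: "'a::real_normed_vector set \<Rightarrow> 'a \<Rightarrow> 'a \<Rightarrow> ereal" where
  "min_time \<Omega> v x = Inf {ereal t | t. 0 \<le> t \<and> x + t *\<^sub>R v \<in> \<Omega>}"

text \<open>
  The subdifferential and lower calmness are meant at points \<open>xb\<close> where \<open>\<psi>\<close> is finite;
  the difference \<open>\<psi> x - \<psi> xb\<close> is then never of the form \<open>\<infinity> - \<infinity>\<close>.
\<close>

definition frechet_subdiff ::
    "('a::real_normed_vector \<Rightarrow> ereal) \<Rightarrow> 'a \<Rightarrow> ('a \<Rightarrow>\<^sub>L real) set" where
  "frechet_subdiff \<psi> xb =
    {xs. \<forall>\<epsilon>>0. \<exists>\<delta>>0. \<forall>x. norm (x - xb) \<le> \<delta> \<longrightarrow>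
       ereal (blinfun_apply xs (x - xb)) \<le> \<psi> x - \<psi> xb + ereal (\<epsilon> * norm (x - xb))}"

text \<open>Meant for base points \<open>y\<close> belonging to \<open>\<Omega>\<close>.\<close>

definition frechet_normal_cone ::
    "'a::real_normed_vector \<Rightarrow> 'a set \<Rightarrow> ('a \<Rightarrow>\<^sub>L real) set" where
  "frechet_normal_cone y \<Omega> =
    {xs. \<forall>\<epsilon>>0. \<exists>\<delta>>0. \<forall>x\<in>\<Omega>. norm (x - y) \<le> \<delta> \<longrightarrow>
       blinfun_apply xs (x - y) \<le> \<epsilon> * norm (x - y)}"

definition lower_calm :: "('a::real_normed_vector \<Rightarrow> ereal) \<Rightarrow> 'a \<Rightarrow> bool" where
  "lower_calm \<psi> xb \<longleftrightarrow>
    (\<exists>l::real. \<exists>\<delta>>0. \<forall>x. norm (x - xb) \<le> \<delta> \<longrightarrow>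
       \<psi> x - \<psi> xb \<ge> ereal (l * norm (x - xb)))"

end

theory Submission
  imports Defs
begin

text \<open>
  Since \<open>\<Omega>\<close> is closed, the infimum defining \<open>T x\<close> is attained. The upper estimates
  \<open>T (xb + s v) \<le> T xb - s\<close>, for real \<open>s \<le> T xb\<close>, force \<open>\<langle>x\<^sup>*, v\<rangle> = -1\<close> on subgradients, and
  \<open>T (w - T xb v) \<le> T xb\<close> for \<open>w \<in> \<Omega>\<close> makes them normal at \<open>xt\<close>.
  Conversely, put \<open>w = x + T x v \<in> \<Omega>\<close>; then
  \<open>\<langle>x\<^sup>*, w - xt\<rangle> = \<langle>x\<^sup>*, x - xb\<rangle> - (T x - T xb)\<close>. The subgradient inequality is trivial if
  \<open>T x - T xb \<ge> \<parallel>x\<^sup>*\<parallel> \<parallel>x - xb\<parallel>\<close>; otherwise lower calmness gives \<open>\<parallel>w - xt\<parallel> = O(\<parallel>x - xb\<parallel>)\<close>,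
  so the normal cone inequality at \<open>w\<close> applies.
\<close>

lemma min_time_le:
  assumes "0 \<le> t" "x + t *\<^sub>R v \<in> \<Omega>"
  shows "min_time \<Omega> v x \<le> ereal t"
  unfolding min_time_def using assms by (intro Inf_lower) auto

text \<open>The admissible times form the part in \<open>{0..}\<close> of a preimage of
  \<open>\<Omega>\<close> under a continuous map. This set is closed and bounded below, and
  finiteness of \<open>min_time \<Omega> v x\<close> makes it nonempty, so it contains its
  infimum.\<close>

lemma min_time_attained:
  fixes \<Omega> :: "'a::real_normed_vector set"
  assumes "closed \<Omega>" "x \<in> domain (min_time \<Omega> v)"
  obtains t where "0 \<le> t" "min_time \<Omega> v x = ereal t" "x + t *\<^sub>R v \<in> \<Omega>"
proof -
  define S where "S = {t. 0 \<le> t \<and> x + t *\<^sub>R v \<in> \<Omega>}"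
  have "closed S"
  proof -
    have "S = {0..} \<inter> (\<lambda>t. x + t *\<^sub>R v) -` \<Omega>"
      by (auto simp: S_def)
    moreover have "closed ((\<lambda>t::real. x + t *\<^sub>R v) -` \<Omega>)"
      using assms(1) by (intro closed_vimage continuous_intros)
    ultimately show ?thesis by auto
  qed
  moreover have "S \<noteq> {}"
    using assms(2) unfolding S_def domain_def min_time_def mem_Collect_eq Inf_less_iff by blast
  moreover have bdd: "bdd_below S"
    by (auto simp: S_def bdd_below_def)
  ultimately have mem: "Inf S \<in> S"
    by (intro closed_contains_Inf)
  have "min_time \<Omega> v x = ereal (Inf S)"
  proof (rule antisym)
    show "min_time \<Omega> v x \<le> ereal (Inf S)"
      using mem by (intro min_time_le) (auto simp: S_def)
    show "ereal (Inf S) \<le> min_time \<Omega> v x"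
      unfolding min_time_def using bdd by (auto simp: le_Inf_iff S_def intro!: cInf_lower)
  qed
  with mem show thesis
    by (intro that[of "Inf S"]) (auto simp: S_def)
qed

text \<open>Moving \<open>xb\<close> along \<open>v\<close> by a small \<open>s\<close> of either
  sign changes the time by at most \<open>-s\<close>. Positive \<open>s\<close> bounds
  \<open>xs v\<close> above by -1, negative \<open>s\<close> bounds it below. Positivity of
  \<open>\<tau>\<close> leaves room for forward moves.\<close>

lemma frechet_subdiff_min_time_direction:
  assumes sub: "xs \<in> frechet_subdiff (min_time \<Omega> v) xb"
    and \<tau>: "min_time \<Omega> v xb = ereal \<tau>" "0 < \<tau>" "xb + \<tau> *\<^sub>R v \<in> \<Omega>"
  shows "blinfun_apply xs v = -1"
proof -
  have est: "\<exists>d>0. \<forall>s. \<bar>s\<bar> \<le> d \<longrightarrow> s * (xs v + 1) \<le> e * \<bar>s\<bar> * norm v" if "e > 0" for e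
  proof -
    obtain \<delta> where \<delta>: "\<delta> > 0" "\<And>x. norm (x - xb) \<le> \<delta> \<Longrightarrow>
        ereal (xs (x - xb)) \<le> min_time \<Omega> v x - min_time \<Omega> v xb + ereal (e * norm (x - xb))"
      using sub \<open>e > 0\<close> unfolding frechet_subdiff_def by blast
    \<comment> \<open>The first bound keeps the remaining time \<open>\<tau> - s\<close>
      nonnegative, the second keeps the moved point within \<open>\<delta>\<close> of
      \<open>xb\<close>; adding 1 makes the denominator positive.\<close>
    have "s * (xs v + 1) \<le> e * \<bar>s\<bar> * norm v" if s: "\<bar>s\<bar> \<le> min \<tau> (\<delta> / (norm v + 1))" for s
    proof -
      have "\<bar>s\<bar> * norm v \<le> \<bar>s\<bar> * (norm v + 1)" by (simp add: mult_left_mono)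
      also have "\<dots> \<le> \<delta>" using s by (simp add: pos_le_divide_eq add_nonneg_pos)
      finally have near: "norm (xb + s *\<^sub>R v - xb) \<le> \<delta>" by simp
      have "min_time \<Omega> v (xb + s *\<^sub>R v) \<le> ereal (\<tau> - s)"
        using s \<tau> by (intro min_time_le) (auto simp: algebra_simps)
      moreover note \<delta>(2)[OF near]
      ultimately have "ereal (s * xs v) \<le> ereal (\<tau> - s) - ereal \<tau> + ereal (e * (\<bar>s\<bar> * norm v))"
        by (cases "min_time \<Omega> v (xb + s *\<^sub>R v)") (auto simp: \<tau> blinfun.scaleR_right)
      then show ?thesis by (simp add: algebra_simps)
    qed
    moreover have "min \<tau> (\<delta> / (norm v + 1)) > 0"
      using \<tau> \<delta> by (simp add: add_nonneg_pos)
    ultimately show ?thesis by blast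
  qed
  have "\<bar>xs v + 1\<bar> \<le> 0 + e" if "e > 0" for e
  proof -
    have pos: "e / (norm v + 1) > 0" using that by (simp add: add_nonneg_pos)
    obtain d where d: "d > 0"
      "\<And>s. \<bar>s\<bar> \<le> d \<Longrightarrow> s * (xs v + 1) \<le> e / (norm v + 1) * \<bar>s\<bar> * norm v"
      using est[OF pos] by blast
    have small: "e / (norm v + 1) * norm v \<le> e"
      using that by (simp add: divide_simps add_nonneg_pos)
    have "d * (e / (norm v + 1) * norm v) \<le> d * e"
      using small d(1) by (intro mult_left_mono) auto
    \<comment> \<open>The choices \<open>s = d\<close> and \<open>s = -d\<close> give the two
      one-sided bounds.\<close>
    then have "d * (xs v + 1) \<le> d * e" "d * - (xs v + 1) \<le> d * e"
      using d(2)[of d] d(2)[of "-d"] d(1) by (simp_all add: algebra_simps)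
    then have "xs v + 1 \<le> e" "- (xs v + 1) \<le> e"
      using d(1) mult_le_cancel_left_pos by blast+
    then show ?thesis by linarith
  qed
  then have "\<bar>xs v + 1\<bar> \<le> 0" by (rule field_le_epsilon)
  then show ?thesis by simp
qed

lemma frechet_subdiff_min_time_normal:
  assumes sub: "xs \<in> frechet_subdiff (min_time \<Omega> v) xb"
    and \<tau>: "min_time \<Omega> v xb = ereal \<tau>" "0 \<le> \<tau>"
  shows "xs \<in> frechet_normal_cone (xb + \<tau> *\<^sub>R v) \<Omega>"
  unfolding frechet_normal_cone_def
proof safe
  fix e :: real assume "e > 0"
  then obtain \<delta> where \<delta>: "\<delta> > 0" "\<And>x. norm (x - xb) \<le> \<delta> \<Longrightarrow>
      ereal (xs (x - xb)) \<le> min_time \<Omega> v x - min_time \<Omega> v xb + ereal (e * norm (x - xb))"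
    using sub unfolding frechet_subdiff_def by blast
  have "xs (w - (xb + \<tau> *\<^sub>R v)) \<le> e * norm (w - (xb + \<tau> *\<^sub>R v))"
    if "w \<in> \<Omega>" and near: "norm (w - (xb + \<tau> *\<^sub>R v)) \<le> \<delta>" for w
  proof -
    \<comment> \<open>Translating by \<open>- \<tau> *\<^sub>R v\<close> preserves displacements, so
      the same \<open>\<delta>\<close> serves; \<open>x\<close> reaches \<open>w\<close> at time
      \<open>\<tau>\<close>, so the time difference is at most 0.\<close>
    define x where "x = w - \<tau> *\<^sub>R v"
    have eq: "w - (xb + \<tau> *\<^sub>R v) = x - xb" by (simp add: x_def)
    have "min_time \<Omega> v x \<le> ereal \<tau>"
      using \<tau> that by (intro min_time_le) (auto simp: x_def)
    moreover have "ereal (xs (x - xb)) \<le> min_time \<Omega> v x - ereal \<tau> + ereal (e * norm (x - xb))"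
      using \<delta>(2)[of x] near by (simp add: eq \<tau>)
    ultimately have "xs (x - xb) \<le> e * norm (x - xb)"
      by (cases "min_time \<Omega> v x") auto
    then show ?thesis by (simp add: eq)
  qed
  with \<delta>(1) show "\<exists>\<delta>>0. \<forall>w\<in>\<Omega>. norm (w - (xb + \<tau> *\<^sub>R v)) \<le> \<delta> \<longrightarrow>
      xs (w - (xb + \<tau> *\<^sub>R v)) \<le> e * norm (w - (xb + \<tau> *\<^sub>R v))" by blast
qed

lemma frechet_subdiff_min_timeI:
  assumes "closed \<Omega>" and \<tau>: "min_time \<Omega> v xb = ereal \<tau>"
    and calm: "lower_calm (min_time \<Omega> v) xb"
    and dir: "blinfun_apply xs v = -1"
    and normal: "xs \<in> frechet_normal_cone (xb + \<tau> *\<^sub>R v) \<Omega>"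
  shows "xs \<in> frechet_subdiff (min_time \<Omega> v) xb"
  unfolding frechet_subdiff_def
proof safe
  fix e :: real assume "e > 0"
  obtain l \<delta> where l: "\<delta> > 0" "\<And>x. norm (x - xb) \<le> \<delta> \<Longrightarrow>
      ereal (l * norm (x - xb)) \<le> min_time \<Omega> v x - min_time \<Omega> v xb"
    using calm unfolding lower_calm_def by blast
  \<comment> \<open>\<open>C\<close> bounds the ratio of the distance of the hitting points to
    \<open>norm (x - xb)\<close> in the nontrivial case below: 1 comes from the shift of the base
    point, the rest from the change of time. Normality is used with \<open>e / C\<close> so that
    this factor cancels.\<close>
  define C where "C = 1 + (\<bar>l\<bar> + norm xs) * norm v"
  have "C > 0" by (simp add: C_def add_pos_nonneg)
  then have "e / C > 0" using \<open>e > 0\<close> by simp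
  then obtain \<eta> where \<eta>: "\<eta> > 0" "\<And>w. w \<in> \<Omega> \<Longrightarrow> norm (w - (xb + \<tau> *\<^sub>R v)) \<le> \<eta> \<Longrightarrow>
      xs (w - (xb + \<tau> *\<^sub>R v)) \<le> e / C * norm (w - (xb + \<tau> *\<^sub>R v))"
    using normal unfolding frechet_normal_cone_def by blast
  have "ereal (xs (x - xb)) \<le> min_time \<Omega> v x - min_time \<Omega> v xb + ereal (e * norm (x - xb))"
    if x: "norm (x - xb) \<le> min \<delta> (\<eta> / C)" for x
  proof (cases "x \<in> domain (min_time \<Omega> v)")
    case False
    \<comment> \<open>The right-hand side is infinite here.\<close>
    then show ?thesis by (simp add: domain_def \<tau>)
  next
    case True
    then obtain t where t: "min_time \<Omega> v x = ereal t" "x + t *\<^sub>R v \<in> \<Omega>"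
      using min_time_attained[OF \<open>closed \<Omega>\<close>] by blast
    define r where "r = norm (x - xb)"
    have lower: "l * r \<le> t - \<tau>" using l(2)[of x] x by (simp add: t \<tau> r_def)
    have bound: "xs (x - xb) \<le> norm xs * r"
      using norm_blinfun[of xs "x - xb"] by (simp add: r_def)
    have "xs (x - xb) \<le> t - \<tau> + e * r"
    proof (cases "norm xs * r \<le> t - \<tau>")
      case True
      moreover have "0 \<le> e * r" using \<open>e > 0\<close> by (simp add: r_def)
      ultimately show ?thesis using bound by linarith
    next
      case False
      \<comment> \<open>Calmness bounds \<open>t - \<tau>\<close> from below and the failed case
        condition bounds it from above, both by multiples of \<open>r\<close>.\<close>
      have "- (\<bar>l\<bar> * r) \<le> l * r"
        using abs_ge_minus_self[of "l * r"] by (simp add: abs_mult r_def)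
      moreover have "0 \<le> \<bar>l\<bar> * r" "0 \<le> norm xs * r" by (simp_all add: r_def)
      ultimately have "\<bar>t - \<tau>\<bar> \<le> (\<bar>l\<bar> + norm xs) * r"
        using lower False by (simp add: algebra_simps)
      then have speed: "\<bar>t - \<tau>\<bar> * norm v \<le> (\<bar>l\<bar> + norm xs) * r * norm v"
        by (rule mult_right_mono) simp
      define w where "w = x + t *\<^sub>R v"
      have w: "w - (xb + \<tau> *\<^sub>R v) = (x - xb) + (t - \<tau>) *\<^sub>R v"
        by (simp add: w_def algebra_simps)
      have "norm (w - (xb + \<tau> *\<^sub>R v)) \<le> r + \<bar>t - \<tau>\<bar> * norm v"
        unfolding w r_def using norm_triangle_ineq[of "x - xb" "(t - \<tau>) *\<^sub>R v"] by simp
      with speed have dist: "norm (w - (xb + \<tau> *\<^sub>R v)) \<le> C * r"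
        by (simp add: C_def algebra_simps)
      also have "C * r \<le> \<eta>"
        using x \<open>C > 0\<close> by (simp add: r_def pos_le_divide_eq mult.commute)
      finally have "xs (w - (xb + \<tau> *\<^sub>R v)) \<le> e / C * norm (w - (xb + \<tau> *\<^sub>R v))"
        using \<eta>(2)[of w] t by (simp add: w_def)
      also have "\<dots> \<le> e / C * (C * r)"
        using dist \<open>e / C > 0\<close> by (intro mult_left_mono) auto
      also have "\<dots> = e * r" using \<open>C > 0\<close> by simp
      finally show ?thesis
        by (simp add: w blinfun.add_right blinfun.scaleR_right dir)
    qed
    then show ?thesis by (simp add: t \<tau> r_def)
  qed
  moreover have "min \<delta> (\<eta> / C) > 0" using l \<eta> \<open>C > 0\<close> by simp
  ultimately show "\<exists>\<delta>>0. \<forall>x. norm (x - xb) \<le> \<delta> \<longrightarrow>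
      ereal (xs (x - xb)) \<le> min_time \<Omega> v x - min_time \<Omega> v xb + ereal (e * norm (x - xb))"
    by blast
qed

theorem theorem3p16:
  fixes \<Omega> :: "'a::real_normed_vector set" and v xb xt :: 'a and T :: "'a \<Rightarrow> ereal"
  assumes "\<Omega> \<noteq> {}" and "closed \<Omega>" and "v \<noteq> 0"
    and "T = min_time \<Omega> v"
    and "xb \<in> domain T - \<Omega>"
    and "xt = xb + real_of_ereal (T xb) *\<^sub>R v"
  shows "frechet_subdiff T xb \<subseteq>
           {xs. blinfun_apply xs v = -1} \<inter> frechet_normal_cone xt \<Omega> \<and>
         (lower_calm T xb \<longrightarrow>
           frechet_subdiff T xb =
             {xs. blinfun_apply xs v = -1} \<inter> frechet_normal_cone xt \<Omega>)"
proof -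
  obtain \<tau> where \<tau>: "0 \<le> \<tau>" "min_time \<Omega> v xb = ereal \<tau>" "xb + \<tau> *\<^sub>R v \<in> \<Omega>"
    using min_time_attained[OF assms(2)] assms(4,5) by blast
  \<comment> \<open>A zero time would put \<open>xb\<close> itself in
    \<open>\<Omega>\<close>.\<close>
  have "\<tau> \<noteq> 0" using \<tau>(3) assms(5) by auto
  with \<tau> have "0 < \<tau>" by simp
  have xt: "xt = xb + \<tau> *\<^sub>R v" using assms(4,6) \<tau> by simp
  have sub: "frechet_subdiff T xb \<subseteq>
      {xs. blinfun_apply xs v = -1} \<inter> frechet_normal_cone xt \<Omega>"
    using frechet_subdiff_min_time_direction[OF _ \<tau>(2) \<open>0 < \<tau>\<close> \<tau>(3)]
      frechet_subdiff_min_time_normal[OF _ \<tau>(2,1)]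
    unfolding assms(4) xt by blast
  moreover have "{xs. blinfun_apply xs v = -1} \<inter> frechet_normal_cone xt \<Omega> \<subseteq> frechet_subdiff T xb"
    if "lower_calm T xb"
    using frechet_subdiff_min_timeI[OF assms(2) \<tau>(2)] that unfolding assms(4) xt by blast
  ultimately show ?thesis by blast
qed

end
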